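(* Let $S$ be an additively idempotent subtractive unique factorisation semidomain and let $I$ be a proper ideal of $S$. Then $I$ is $k$-strongly irreducible if and only if for all $x,y\in S$ and $z\in I$, $\operatorname{lcm}(x,y)\leqslant z$ implies $x\in I$ or $y\in I$.
   Context: A semiring is a commutative semiring $(S,+,0,\cdot,1)$ with multiplicative identity $1$ and additive identity $0$ that is absorbing. It is additively idempotent if $x+x=x$ for all $x$; then the natural partial order is $x\leqslant y\iff x+y=y$. An ideal is a nonempty subset closed under addition and under multiplication by elements of $S$. A $k$-ideal is an ideal $I$ such that $x+y\in I$ and $y\in I$ imply $x\in I$. $S$ is subtractive if every ideal is a $k$-ideal. $S$ is a semidomain if $ab=ac$ with $a\ne0$ implies $b=c$. A non-zero non-unit $r$ is irreducible if $r=r_1r_2$ implies $r_1$ or $r_2$ is a unit; $p$ is prime if $\langle p\rangle$ is a prime ideal. A semidomain is a unique factorisation semidomain if every irreducible element is prime and every non-zero non-unit is uniquely (up to order and units) a product of irreducible elements. $\operatorname{lcm}(x,y)$ is a least common multiple with respect to divisibility, unique up to units, with $\operatorname{lcm}(x,0)=0$. A $k$-ideal $I$ is $k$-strongly irreducible if for all $k$-ideals $A,B$, $A\cap B\subseteq I$ implies $A\subseteq I$ or $B\subseteq I$. *)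

theory Defs
  imports HOL.Hull "HOL-Library.Multiset" "HOL-Computational_Algebra.Factorial_Ring"
begin

definition additively_idempotent :: "'a::comm_semiring_1 itself \<Rightarrow> bool" where
  "additively_idempotent _ \<longleftrightarrow> (\<forall>x::'a. x + x = x)"

definition natural_le :: "'a::comm_semiring_1 \<Rightarrow> 'a \<Rightarrow> bool"  (infix \<open>\<preceq>\<close> 50) where
  "x \<preceq> y \<longleftrightarrow> x + y = y"

definition semiring_ideal :: "'a::comm_semiring_1 set \<Rightarrow> bool" where
  "semiring_ideal I \<longleftrightarrow>
     I \<noteq> {} \<and> (\<forall>x\<in>I. \<forall>y\<in>I. x + y \<in> I) \<and> (\<forall>s. \<forall>x\<in>I. s * x \<in> I)"

definition k_ideal :: "'a::comm_semiring_1 set \<Rightarrow> bool" where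
  "k_ideal I \<longleftrightarrow> semiring_ideal I \<and> (\<forall>x y. x + y \<in> I \<and> y \<in> I \<longrightarrow> x \<in> I)"

definition subtractive :: "'a::comm_semiring_1 itself \<Rightarrow> bool" where
  "subtractive _ \<longleftrightarrow> (\<forall>I::'a set. semiring_ideal I \<longrightarrow> k_ideal I)"

definition prime_ideal :: "'a::comm_semiring_1 set \<Rightarrow> bool" where
  "prime_ideal P \<longleftrightarrow>
     semiring_ideal P \<and> P \<noteq> UNIV \<and> (\<forall>a b. a * b \<in> P \<longrightarrow> a \<in> P \<or> b \<in> P)"

(* semiring_ideal hull {p} is the ideal generated by p.  Unlike prime_elem of the library,
   this notion does not exclude p = 0. *)
definition prime_element :: "'a::comm_semiring_1 \<Rightarrow> bool" where
  "prime_element p \<longleftrightarrow> prime_ideal (semiring_ideal hull {p})"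

definition unit_associated :: "'a::comm_semiring_1 \<Rightarrow> 'a \<Rightarrow> bool" where
  "unit_associated a b \<longleftrightarrow> (\<exists>u. u dvd 1 \<and> a = u * b)"

definition irreducible_factorisation :: "'a::comm_semiring_1 \<Rightarrow> 'a multiset \<Rightarrow> bool" where
  "irreducible_factorisation r F \<longleftrightarrow> (\<forall>p\<in>#F. irreducible p) \<and> prod_mset F = r"

(* A semidomain is a multiplicatively cancellative commutative semiring; this is what the class
   semiring_no_zero_divisors_cancel expresses on top of comm_semiring_1 (its axiom that there are
   no zero divisors is cancellation applied to a * b = a * 0). *)
definition unique_factorisation_semidomain ::
    "'a::{comm_semiring_1, semiring_no_zero_divisors_cancel} itself \<Rightarrow> bool" where
  "unique_factorisation_semidomain _ \<longleftrightarrow>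
     (\<forall>p::'a. irreducible p \<longrightarrow> prime_element p) \<and>
     (\<forall>r::'a. r \<noteq> 0 \<and> \<not> r dvd 1 \<longrightarrow>
        (\<exists>F. irreducible_factorisation r F) \<and>
        (\<forall>F G. irreducible_factorisation r F \<and> irreducible_factorisation r G \<longrightarrow>
           rel_mset unit_associated F G))"

(* A relation, since least common multiples are determined only up to units. *)
definition is_lcm :: "'a::comm_semiring_1 \<Rightarrow> 'a \<Rightarrow> 'a \<Rightarrow> bool" where
  "is_lcm x y m \<longleftrightarrow> x dvd m \<and> y dvd m \<and> (\<forall>n. x dvd n \<and> y dvd n \<longrightarrow> m dvd n)"

(* The convention lcm (x, 0) = 0 is not a separate clause: it follows from the definition. *)
lemma is_lcm_0_right: "is_lcm x 0 m \<longleftrightarrow> m = 0"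
  by (auto simp: is_lcm_def)

definition k_strongly_irreducible :: "'a::comm_semiring_1 set \<Rightarrow> bool" where
  "k_strongly_irreducible I \<longleftrightarrow>
     k_ideal I \<and> (\<forall>A B. k_ideal A \<and> k_ideal B \<and> A \<inter> B \<subseteq> I \<longrightarrow> A \<subseteq> I \<or> B \<subseteq> I)"

end

theory Submission
  imports Defs
begin

text \<open>
  In a subtractive additively idempotent semiring, \<open>x + (x + y) = x + y\<close> puts \<open>x\<close> into the
  k-ideal generated by \<open>x + y\<close>. Hence \<open>x + y\<close> is a greatest common divisor of \<open>x\<close> and \<open>y\<close>,
  and with \<open>x = (x + y) u\<close>, \<open>y = (x + y) v\<close> cancellation gives \<open>u + v = 1\<close>, a Bezout identity,
  so that \<open>(x + y) u v\<close> is a least common multiple. Least common multiples therefore exist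
  without recourse to factorisations, and they turn intersections of principal
  ideals into principal ideals; this is all the equivalence needs.
\<close>

lemma semiring_ideal_multiples: "semiring_ideal {n. x dvd n}"
  by (auto simp: semiring_ideal_def)

lemma add_dvd_left:
  fixes x y :: "'a::comm_semiring_1"
  assumes "additively_idempotent TYPE('a)" and "subtractive TYPE('a)"
  shows "x + y dvd x"
proof -
  have "k_ideal {n. x + y dvd n}"
    using assms(2) semiring_ideal_multiples by (auto simp: subtractive_def)
  moreover have "x + (x + y) = x + y"
    using assms(1) by (simp add: additively_idempotent_def flip: add.assoc)
  ultimately show ?thesis
    unfolding k_ideal_def mem_Collect_eq by (metis dvd_refl)
qed

text \<open>A common multiple \<open>n\<close> equals \<open>n * u + n * v\<close>, and
  \<open>d * u * v\<close> divides both summands: the first because \<open>d * v\<close> divides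
  \<open>n\<close>, the second because \<open>d * u\<close> does.\<close>

lemma is_lcm_of_bezout:
  fixes d u v :: "'a::comm_semiring_1"
  assumes "u + v = 1"
  shows "is_lcm (d * u) (d * v) (d * u * v)"
  unfolding is_lcm_def
proof (intro conjI allI impI)
  show "d * v dvd d * u * v"
    by (simp add: mult_dvd_mono)
  fix n assume n: "d * u dvd n \<and> d * v dvd n"
  have "d * u * v dvd n * u"
    using mult_dvd_mono[of "d * v" n u u] n by (simp add: mult_ac)
  moreover have "d * u * v dvd n * v"
    using n by (simp add: mult_dvd_mono)
  ultimately have "d * u * v dvd n * (u + v)"
    by (simp add: distrib_left)
  then show "d * u * v dvd n"
    using assms by simp
qed simp

lemma is_lcm_exists:
  fixes x y :: "'a::{comm_semiring_1, semiring_no_zero_divisors_cancel}"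
  assumes "additively_idempotent TYPE('a)" and "subtractive TYPE('a)"
  shows "\<exists>l. is_lcm x y l"
proof -
  obtain u where u: "x = (x + y) * u"
    using add_dvd_left[OF assms, of x y] by (elim dvdE)
  obtain v where v: "y = (x + y) * v"
    using add_dvd_left[OF assms, of y x] by (metis add.commute dvdE)
  show ?thesis
  proof (cases "x + y = 0")
    \<comment> \<open>Here \<open>x + y\<close> cannot be cancelled, but \<open>y\<close>, being a
      multiple of it, vanishes.\<close>
    case True
    then have "y = 0" by (subst v) simp
    then have "is_lcm x y 0" by (simp add: is_lcm_0_right)
    then show ?thesis ..
  next
    case False
    \<comment> \<open>The sum of \<open>u\<close> and \<open>v\<close>, folded from right to left
      because \<open>x\<close> and \<open>y\<close> recur on their right-hand sides.\<close>
    have "(x + y) * (u + v) = (x + y) * 1"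
      by (simp only: distrib_left mult_1_right flip: u v)
    then have "u + v = 1"
      using False by (simp only: mult_cancel_left) simp
    then have "is_lcm ((x + y) * u) ((x + y) * v) ((x + y) * u * v)"
      by (rule is_lcm_of_bezout)
    then have "is_lcm x y ((x + y) * u * v)"
      by (simp only: flip: u v)
    then show ?thesis ..
  qed
qed

lemma semiring_ideal_dvd_closed:
  assumes "semiring_ideal A" and "a \<in> A" and "a dvd b"
  shows "b \<in> A"
  using assms by (auto simp: semiring_ideal_def mult.commute elim!: dvdE)

theorem theorem6p17:
  fixes I :: "'a::{comm_semiring_1, semiring_no_zero_divisors_cancel} set"
  assumes "additively_idempotent TYPE('a)"
    and "subtractive TYPE('a)"
    and "unique_factorisation_semidomain TYPE('a)"
    and "semiring_ideal I" and "I \<noteq> UNIV"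
  shows "k_strongly_irreducible I \<longleftrightarrow>
    (\<forall>x y. \<forall>z\<in>I. \<forall>l. is_lcm x y l \<and> l \<preceq> z \<longrightarrow> x \<in> I \<or> y \<in> I)"
proof
  have k: "k_ideal J" if "semiring_ideal J" for J :: "'a set"
    using assms(2) that by (simp add: subtractive_def)
  {
    assume irr: "k_strongly_irreducible I"
    show "\<forall>x y. \<forall>z\<in>I. \<forall>l. is_lcm x y l \<and> l \<preceq> z \<longrightarrow> x \<in> I \<or> y \<in> I"
    proof (intro allI ballI impI)
      fix x y z l
      assume z: "z \<in> I" and "is_lcm x y l \<and> l \<preceq> z"
      then have lcm: "is_lcm x y l" and "l + z = z"
        by (auto simp: natural_le_def)
      \<comment> \<open>The k-ideal property applied to \<open>l + z = z\<close>.\<close>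
      then have "l \<in> I"
        using k[OF assms(4)] z unfolding k_ideal_def by metis
      \<comment> \<open>Every common multiple of \<open>x\<close> and \<open>y\<close> is a multiple
        of \<open>l\<close>.\<close>
      then have "{n. x dvd n} \<inter> {n. y dvd n} \<subseteq> I"
        using lcm semiring_ideal_dvd_closed[OF assms(4)] unfolding is_lcm_def by blast
      then have "{n. x dvd n} \<subseteq> I \<or> {n. y dvd n} \<subseteq> I"
        using irr k[OF semiring_ideal_multiples] by (simp add: k_strongly_irreducible_def)
      then show "x \<in> I \<or> y \<in> I"
        using dvd_refl by blast
    qed
  }
  assume H: "\<forall>x y. \<forall>z\<in>I. \<forall>l. is_lcm x y l \<and> l \<preceq> z \<longrightarrow> x \<in> I \<or> y \<in> I"
  show "k_strongly_irreducible I"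
    unfolding k_strongly_irreducible_def
  proof (intro conjI allI impI)
    show "k_ideal I" using k assms(4) .
    fix A B :: "'a set"
    assume AB: "k_ideal A \<and> k_ideal B \<and> A \<inter> B \<subseteq> I"
    \<comment> \<open>This suffices: otherwise some \<open>a\<close> in \<open>A\<close> and some
      \<open>b\<close> in \<open>B\<close> would both lie outside \<open>I\<close>.\<close>
    have "a \<in> I \<or> b \<in> I" if "a \<in> A" "b \<in> B" for a b
    proof -
      obtain l where l: "is_lcm a b l"
        using is_lcm_exists[OF assms(1,2)] by blast
      then have "l \<in> A" "l \<in> B"
        using AB that semiring_ideal_dvd_closed unfolding is_lcm_def k_ideal_def by blast+
      then have "l \<in> I"
        using AB by blast
      \<comment> \<open>The bound \<open>z\<close> in \<open>H\<close> is taken to be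
        \<open>l\<close> itself.\<close>
      moreover have "l \<preceq> l"
        using assms(1) by (simp add: natural_le_def additively_idempotent_def)
      ultimately show ?thesis
        using H l by blast
    qed
    then show "A \<subseteq> I \<or> B \<subseteq> I"
      by blast
  qed
qed

end
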